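(* Let $G$ be a graph on $n$ vertices with $X\in M_n$ and let $H$ be a graph on $m$ vertices with $Y\in M_m$. Then $$\|X\otimes Y+\mathcal{S}_{G\boxtimes H}^{\perp}\|_{\mathrm{osp}}=\|X+\mathcal{S}_G^{\perp}\|_{\mathrm{osp}}\cdot\|Y+\mathcal{S}_H^{\perp}\|_{\mathrm{osp}},$$ that is, $d_\infty(G\boxtimes H,X\otimes Y)=d_\infty(G,X)\cdot d_\infty(H,Y)$.
   Context: $M_n$ denotes the complex $n\times n$ matrices with the operator norm $\|\cdot\|$, with matrix units $E_{i,j}$; $M_n\otimes M_m$ is identified with $M_{nm}$. A graph $G$ on $n$ vertices is a symmetric subset $G\subseteq\{1,\dots,n\}^2$ containing no $(i,i)$; $\widetilde G=G\cup\{(i,i):1\le i\le n\}$. The operator system of $G$ is $\mathcal{S}_G=\operatorname{span}\{E_{i,j}:(i,j)\in\widetilde G\}$, and $\mathcal{S}_G^\perp$ is its orthogonal complement in $M_n$ for the inner product $(a,b)=\operatorname{tr}(ab^* )$, i.e. $\mathcal{S}_G^\perp=\operatorname{span}\{E_{i,j}:(i,j)\notin\widetilde G\}$. The strong product $G\boxtimes H$ is the graph on the $nm$ vertices $(i,j)$, $1\le i\le n$, $1\le j\le m$, with $((i,j),(k,l))\in G\boxtimes H$ iff [$(i,k)\in G$ and $j=l$] or [$(j,l)\in H$ and $i=k$] or [$(i,k)\in G$ and $(j,l)\in H$]; then $\mathcal{S}_{G\boxtimes H}=\mathcal{S}_G\otimes\mathcal{S}_H\subseteq M_{nm}$. The operator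 space quotient norm is $d_\infty(G,X):=\|X+\mathcal{S}_G^\perp\|_{\mathrm{osp}}=\inf\{\|X+K\|:K\in\mathcal{S}_G^\perp\}$. *)

theory Defs
  imports "HOL-Analysis.Analysis"
begin

text \<open>
  Matrices in \<open>M\<^sub>n\<close> have type \<open>complex ^ 'n ^ 'n\<close>, with vertex set the finite type \<open>'n\<close>, and a graph on
  it is a relation \<open>G\<close> with \<open>sym G\<close> and \<open>irrefl G\<close>.  \<open>M\<^sub>n \<otimes> M\<^sub>m = M\<^sub>n\<^sub>m\<close> is realised by the index type
  \<open>'n \<times> 'm\<close>, which is also the vertex set of the strong product.
\<close>

definition cscale :: "complex \<Rightarrow> complex ^ 'n ^ 'm \<Rightarrow> complex ^ 'n ^ 'm" where
  "cscale c A = (\<chi> i j. c * A $ i $ j)"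

text \<open>The span of matrices must be the complex one; the library's \<open>span\<close> is over the reals.\<close>

interpretation cmat: vector_space "cscale :: complex \<Rightarrow> complex ^ 'n ^ 'm \<Rightarrow> complex ^ 'n ^ 'm"
  by unfold_locales (simp_all add: cscale_def vec_eq_iff algebra_simps)

definition matrix_unit :: "'n \<Rightarrow> 'n \<Rightarrow> complex ^ 'n ^ 'n" where
  "matrix_unit i j = (\<chi> k l. if k = i \<and> l = j then 1 else 0)"

definition conj_transpose :: "complex ^ 'n ^ 'm \<Rightarrow> complex ^ 'm ^ 'n" where
  "conj_transpose A = (\<chi> i j. cnj (A $ j $ i))"

definition trace_inner :: "complex ^ 'n ^ 'n \<Rightarrow> complex ^ 'n ^ 'n \<Rightarrow> complex" where
  "trace_inner A B = trace (A ** conj_transpose B)"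

definition orth_complement :: "(complex ^ 'n ^ 'n) set \<Rightarrow> (complex ^ 'n ^ 'n) set" where
  "orth_complement S = {A. \<forall>B\<in>S. trace_inner A B = 0}"

text \<open>The norm on \<open>complex ^ 'n\<close> is the Euclidean one, so this is the usual operator norm.\<close>

definition op_norm :: "complex ^ 'n ^ 'n \<Rightarrow> real" where
  "op_norm A = onorm (\<lambda>v. A *v v)"

definition tensor :: "complex ^ 'n ^ 'n \<Rightarrow> complex ^ 'm ^ 'm \<Rightarrow> complex ^ ('n \<times> 'm) ^ ('n \<times> 'm)"
    (infixr "\<otimes>\<^sub>M" 70) where
  "X \<otimes>\<^sub>M Y = (\<chi> p q. X $ fst p $ fst q * Y $ snd p $ snd q)"

definition op_system :: "('n \<times> 'n) set \<Rightarrow> (complex ^ 'n ^ 'n) set" where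
  "op_system G = cmat.span {matrix_unit i j | i j. (i, j) \<in> G \<union> Id}"

definition strong_product ::
    "('n \<times> 'n) set \<Rightarrow> ('m \<times> 'm) set \<Rightarrow> (('n \<times> 'm) \<times> ('n \<times> 'm)) set" (infixr "\<boxtimes>" 70) where
  "G \<boxtimes> H = {((i, j), (k, l)) | i j k l.
     (i, k) \<in> G \<and> j = l \<or> (j, l) \<in> H \<and> i = k \<or> (i, k) \<in> G \<and> (j, l) \<in> H}"

text \<open>\<open>osp_norm X J\<close> is the norm of the coset \<open>X + J\<close>.\<close>

definition osp_norm :: "complex ^ 'n ^ 'n \<Rightarrow> (complex ^ 'n ^ 'n) set \<Rightarrow> real" where
  "osp_norm X J = (INF K\<in>J. op_norm (X + K))"

definition d_inf :: "('n \<times> 'n) set \<Rightarrow> complex ^ 'n ^ 'n \<Rightarrow> real" where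
  "d_inf G X = osp_norm X (orth_complement (op_system G))"

end

theory Submission
  imports Defs
begin

text \<open>
  In coordinates \<open>\<S>\<^sub>G\<^sup>\<bottom>\<close> consists of the matrices that vanish on the pattern \<open>G \<union> Id\<close>, and the
  pattern of \<open>G \<boxtimes> H\<close> is the product of the patterns of \<open>G\<close> and \<open>H\<close>.  The theorem is thus an instance
  of a statement about patterns \<open>R\<close> and \<open>Q\<close> (\<open>osp_norm_tensor_vanishing_on\<close>), which has an easy half
  and a dual half.

  For \<open>\<le>\<close>, if \<open>K\<close> and \<open>L\<close> vanish on \<open>R\<close> and \<open>Q\<close>, then \<open>(X + K) \<otimes> (Y + L)\<close> differs from \<open>X \<otimes> Y\<close> by a
  matrix that vanishes on the product pattern, and its operator norm is at most
  \<open>\<parallel>X + K\<parallel> \<parallel>Y + L\<parallel>\<close> (\<open>op_norm_tensor_le\<close>).  Take infima over \<open>K\<close> and \<open>L\<close>.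

  For \<open>\<ge>\<close>, the distance from \<open>X\<close> to a subspace is the largest value at \<open>X\<close> of a functional of norm at
  most one that kills the subspace.  Under the trace pairing such functionals are matrices of trace
  norm at most one supported in \<open>R\<close>.  If \<open>S\<close> and \<open>T\<close> are optimal for \<open>X\<close> and \<open>Y\<close>, then \<open>S \<otimes> T\<close> is
  supported in the product pattern and takes the value \<open>\<parallel>X + \<S>\<^sub>G\<^sup>\<bottom>\<parallel> \<parallel>Y + \<S>\<^sub>H\<^sup>\<bottom>\<parallel>\<close> at \<open>X \<otimes> Y\<close>; it remains
  to see that its trace norm is at most one.

  For this the trace-norm ball is described as the convex hull of the rank-one matrices \<open>u v\<^sup>*\<close> with
  \<open>u\<close> and \<open>v\<close> in the unit ball (\<open>dual_ball\<close>).  It is closed under tensor products because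
  \<open>u v\<^sup>* \<otimes> w z\<^sup>* = (u \<otimes> w) (v \<otimes> z)\<^sup>*\<close> (\<open>dual_ball_tensor\<close>), and a separating hyperplane produces the
  optimal functional inside it (\<open>norming_functional_exists\<close>).
\<close>

section \<open>Patterns of zeros and the trace pairing\<close>

lemma trace_inner_eq_sum:
  "trace_inner A B = (\<Sum>i\<in>UNIV. \<Sum>j\<in>UNIV. A $ i $ j * cnj (B $ i $ j))"
  by (simp add: trace_inner_def trace_def matrix_matrix_mult_def conj_transpose_def)

text \<open>
  The inner product on the right is that of a real Euclidean space.  Through this identity real
  convex separation applies to the complex trace pairing.
\<close>

lemma Re_trace_inner: "Re (trace_inner A B) = inner A B"
  by (simp add: trace_inner_eq_sum inner_vec_def inner_complex_def)

lemma trace_inner_add_left: "trace_inner (A + B) C = trace_inner A C + trace_inner B C"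
  by (simp add: trace_inner_eq_sum algebra_simps sum.distrib)

lemma linear_trace_inner: "linear (trace_inner A)"
  by (rule linearI)
    (simp_all add: trace_inner_eq_sum algebra_simps sum.distrib scaleR_sum_right)

definition vanishing_on :: "('n \<times> 'n) set \<Rightarrow> (complex ^ 'n ^ 'n) set" where
  "vanishing_on R = {A. \<forall>(i, j)\<in>R. A $ i $ j = 0}"

text \<open>
  Pairing with a matrix unit reads off an entry, and the matrices orthogonal to a fixed \<open>A\<close> form a
  complex subspace, so it suffices to test \<open>A\<close> on the spanning matrix units.
\<close>

lemma orth_complement_op_system:
  fixes G :: "('n::finite \<times> 'n) set"
  shows "orth_complement (op_system G) = vanishing_on (G \<union> Id)"
proof (rule set_eqI)
  fix A :: "complex ^ 'n ^ 'n"
  have unit: "trace_inner A (matrix_unit i j) = A $ i $ j" for i j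
  proof -
    have "A $ k $ l * cnj (matrix_unit i j $ k $ l)
        = (if l = j then if k = i then A $ k $ l else 0 else 0)" for k l
      by (simp add: matrix_unit_def)
    then show ?thesis by (simp add: trace_inner_eq_sum)
  qed
  let ?U = "{matrix_unit i j | i j. (i, j) \<in> G \<union> Id}"
  have subspace: "cmat.subspace {B. trace_inner A B = 0}"
  proof (rule cmat.subspaceI)
    have "trace_inner A (cscale c B) = cnj c * trace_inner A B" for c B
      by (simp add: trace_inner_eq_sum cscale_def sum_distrib_left mult.left_commute)
    then show "cscale c B \<in> {B. trace_inner A B = 0}" if "B \<in> {B. trace_inner A B = 0}" for c B
      using that by simp
  qed (simp_all add: linear_0[OF linear_trace_inner] linear_add[OF linear_trace_inner])
  have "A \<in> orth_complement (op_system G) \<longleftrightarrow> cmat.span ?U \<subseteq> {B. trace_inner A B = 0}"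
    by (auto simp: orth_complement_def op_system_def)
  also have "\<dots> \<longleftrightarrow> ?U \<subseteq> {B. trace_inner A B = 0}"
    using cmat.span_minimal[OF _ subspace, of ?U] cmat.span_superset[of ?U]
    by (meson subset_trans)
  also have "\<dots> \<longleftrightarrow> (\<forall>i j. (i, j) \<in> G \<union> Id \<longrightarrow> trace_inner A (matrix_unit i j) = 0)"
    by blast
  also have "\<dots> \<longleftrightarrow> A \<in> vanishing_on (G \<union> Id)"
    unfolding unit vanishing_on_def by blast
  finally show "A \<in> orth_complement (op_system G) \<longleftrightarrow> A \<in> vanishing_on (G \<union> Id)" .
qed

definition rel_tensor :: "('n \<times> 'n) set \<Rightarrow> ('m \<times> 'm) set \<Rightarrow> (('n \<times> 'm) \<times> ('n \<times> 'm)) set" where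
  "rel_tensor R S = {(p, q). (fst p, fst q) \<in> R \<and> (snd p, snd q) \<in> S}"

lemma strong_product_reflexive_closure: "(G \<boxtimes> H) \<union> Id = rel_tensor (G \<union> Id) (H \<union> Id)"
  by (auto simp: strong_product_def rel_tensor_def)

lemma sum_prod_UNIV:
  fixes f :: "'n::finite \<times> 'm::finite \<Rightarrow> 'a::comm_monoid_add"
  shows "(\<Sum>p\<in>UNIV. f p) = (\<Sum>i\<in>UNIV. \<Sum>k\<in>UNIV. f (i, k))"
  by (simp add: UNIV_Times_UNIV[symmetric] sum.cartesian_product del: UNIV_Times_UNIV)

lemma trace_inner_tensor:
  "trace_inner (X \<otimes>\<^sub>M Y) (S \<otimes>\<^sub>M T) = trace_inner X S * trace_inner Y T"
proof -
  have "trace_inner (X \<otimes>\<^sub>M Y) (S \<otimes>\<^sub>M T) = (\<Sum>i\<in>UNIV. \<Sum>k\<in>UNIV. \<Sum>j\<in>UNIV. \<Sum>l\<in>UNIV.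
      (X $ i $ j * cnj (S $ i $ j)) * (Y $ k $ l * cnj (T $ k $ l)))"
    by (simp add: trace_inner_eq_sum sum_prod_UNIV tensor_def ac_simps)
  also have "\<dots> = trace_inner X S * trace_inner Y T"
    by (simp add: trace_inner_eq_sum sum_product)
  finally show ?thesis .
qed

section \<open>The operator norm\<close>

lemma norm_matrix_vector_le: "norm (A *v v) \<le> op_norm A * norm v"
  unfolding op_norm_def by (rule onorm[OF matrix_vector_mul_bounded_linear])

lemma op_norm_nonneg: "0 \<le> op_norm A"
  unfolding op_norm_def by (rule onorm_pos_le[OF matrix_vector_mul_bounded_linear])

lemma op_norm_cscale_le: "op_norm (cscale c A) \<le> norm c * op_norm A"
  unfolding op_norm_def[of "cscale c A"]
proof (rule onorm_bound)
  show "0 \<le> norm c * op_norm A" by (simp add: op_norm_nonneg)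
  fix v
  have "cscale c A *v v = (\<chi> i. c * (A *v v) $ i)"
    by (simp add: vec_eq_iff cscale_def matrix_vector_mult_def sum_distrib_left mult.assoc)
  then have "norm (cscale c A *v v) = norm c * norm (A *v v)"
    by (simp add: norm_vec_def norm_mult L2_set_right_distrib)
  then show "norm (cscale c A *v v) \<le> norm c * op_norm A * norm v"
    by (simp add: norm_matrix_vector_le mult_left_mono mult.assoc)
qed

text \<open>
  The matrix \<open>A \<otimes> B\<close> acts on a vector indexed by pairs by applying \<open>B\<close> to every row and then \<open>A\<close> to
  every column of the result.  As the squared norm of the vector is the sum of the squared norms of
  its rows, and also of its columns, each step costs one operator norm.
\<close>

lemma op_norm_tensor_le:
  fixes A :: "complex ^ 'n::finite ^ 'n" and B :: "complex ^ 'm::finite ^ 'm"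
  shows "op_norm (A \<otimes>\<^sub>M B) \<le> op_norm A * op_norm B"
  unfolding op_norm_def[of "A \<otimes>\<^sub>M B"]
proof (rule onorm_bound)
  show "0 \<le> op_norm A * op_norm B" by (simp add: op_norm_nonneg)
  fix v :: "complex ^ ('n \<times> 'm)"
  have norm_sq: "(norm x)\<^sup>2 = (\<Sum>i\<in>UNIV. (norm (x $ i))\<^sup>2)" for x :: "complex ^ 'k::finite"
    by (simp add: norm_vec_def L2_set_def sum_nonneg)
  have mono_sq: "(norm (M *v x))\<^sup>2 \<le> (op_norm M)\<^sup>2 * (norm x)\<^sup>2"
    for M :: "complex ^ 'k::finite ^ 'k" and x
    using power_mono[OF norm_matrix_vector_le[of M x], of 2] by (simp add: power_mult_distrib)
  define row where "row j = (\<chi> l. v $ (j, l))" for j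
  define w where "w k = (\<chi> j. (B *v row j) $ k)" for k
  have entry: "((A \<otimes>\<^sub>M B) *v v) $ (i, k) = (A *v w k) $ i" for i k
    by (simp add: matrix_vector_mult_def tensor_def w_def row_def sum_prod_UNIV
        sum_distrib_left mult.assoc)
  have "(norm ((A \<otimes>\<^sub>M B) *v v))\<^sup>2 = (\<Sum>i\<in>UNIV. \<Sum>k\<in>UNIV. (norm ((A *v w k) $ i))\<^sup>2)"
    by (simp add: norm_sq sum_prod_UNIV entry)
  also have "\<dots> = (\<Sum>k\<in>UNIV. (norm (A *v w k))\<^sup>2)"
    unfolding norm_sq by (rule sum.swap)
  also have "\<dots> \<le> (\<Sum>k\<in>UNIV. (op_norm A)\<^sup>2 * (norm (w k))\<^sup>2)"
    by (intro sum_mono mono_sq)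
  also have "\<dots> = (op_norm A)\<^sup>2 * (\<Sum>k\<in>UNIV. \<Sum>j\<in>UNIV. (norm ((B *v row j) $ k))\<^sup>2)"
    by (simp add: norm_sq[of "w _"] sum_distrib_left) (simp add: w_def)
  also have "\<dots> = (op_norm A)\<^sup>2 * (\<Sum>j\<in>UNIV. (norm (B *v row j))\<^sup>2)"
    unfolding norm_sq by (subst sum.swap) simp
  also have "\<dots> \<le> (op_norm A)\<^sup>2 * (\<Sum>j\<in>UNIV. (op_norm B)\<^sup>2 * (norm (row j))\<^sup>2)"
    by (intro mult_left_mono sum_mono mono_sq) simp
  also have "\<dots> = (op_norm A * op_norm B * norm v)\<^sup>2"
    by (simp add: norm_sq sum_prod_UNIV row_def power_mult_distrib flip: sum_distrib_left)
  finally show "norm ((A \<otimes>\<^sub>M B) *v v) \<le> op_norm A * op_norm B * norm v"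
    by (rule power2_le_imp_le) (simp add: op_norm_nonneg)
qed

section \<open>The unit ball of the dual norm\<close>

definition outer :: "complex ^ 'n \<Rightarrow> complex ^ 'n \<Rightarrow> complex ^ 'n ^ 'n" where
  "outer u v = (\<chi> i j. u $ i * cnj (v $ j))"

text \<open>
  This is the unit ball of the trace norm.  Describing it as a convex hull of rank-one matrices makes
  its behaviour under tensor products immediate.
\<close>

definition dual_ball :: "(complex ^ 'n::finite ^ 'n) set" where
  "dual_ball = convex hull {outer u v | u v. norm u \<le> 1 \<and> norm v \<le> 1}"

lemma outer_in_dual_ball: "norm u \<le> 1 \<Longrightarrow> norm v \<le> 1 \<Longrightarrow> outer u v \<in> dual_ball"
  unfolding dual_ball_def by (rule hull_inc) blast

lemma convex_dual_ball: "convex dual_ball"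
  by (simp add: dual_ball_def)

lemma dual_ball_subset:
  assumes "convex C" "\<And>u v. norm u \<le> 1 \<Longrightarrow> norm v \<le> 1 \<Longrightarrow> outer u v \<in> C"
  shows "dual_ball \<subseteq> C"
  unfolding dual_ball_def using assms by (intro hull_minimal) auto

lemma inner_outer: "inner A (outer u v) = inner (A *v v) u"
proof -
  have "inner a (b * cnj c) = inner (a * c) b" for a b c :: complex
    by (simp add: inner_complex_def algebra_simps)
  then show ?thesis
    by (simp add: inner_vec_def outer_def matrix_vector_mult_def inner_sum_left)
qed

lemma inner_le_op_norm:
  assumes "S \<in> dual_ball"
  shows "inner A S \<le> op_norm A"
proof -
  have "inner A (outer u v) \<le> op_norm A" if "norm u \<le> 1" "norm v \<le> 1" for u v
  proof -
    have "inner A (outer u v) \<le> norm (A *v v) * norm u"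
      by (simp add: inner_outer norm_cauchy_schwarz)
    also have "\<dots> \<le> norm (A *v v)"
      using that by (simp add: mult_left_le)
    also have "\<dots> \<le> op_norm A * norm v"
      by (rule norm_matrix_vector_le)
    also have "\<dots> \<le> op_norm A"
      using that by (simp add: mult_left_le op_norm_nonneg)
    finally show ?thesis .
  qed
  then have "dual_ball \<subseteq> {S. inner A S \<le> op_norm A}"
    by (intro dual_ball_subset) (auto simp: convex_halfspace_le)
  with assms show ?thesis by blast
qed

text \<open>
  Rank-one matrices detect the operator norm: pairing \<open>A\<close> with \<open>u v\<^sup>*\<close>, where \<open>v\<close> has norm one
  and \<open>u\<close> is the normalisation of \<open>A v\<close>, gives the norm of \<open>A v\<close>.
\<close>

lemma op_norm_le_dual:
  assumes "\<And>S. S \<in> dual_ball \<Longrightarrow> inner A S \<le> r"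
  shows "op_norm A \<le> r"
  unfolding op_norm_def
proof (rule onorm_le)
  fix v
  have outer: "inner (A *v v) u \<le> r" if "norm u \<le> 1" "norm v \<le> 1" for u v
    using assms[OF outer_in_dual_ball[OF that]] unfolding inner_outer .
  have scale: "A *v (c *\<^sub>R v) = c *\<^sub>R (A *v v)" for c
    by (rule linear_scale) (simp add: bounded_linear.linear)
  have unit: "inner (A *v sgn v) (sgn (A *v v)) = norm (A *v v) / norm v"
    by (cases "A *v v = 0")
      (simp_all add: sgn_div_norm scale dot_square_norm power2_eq_square field_simps)
  have "norm (A *v v) / norm v \<le> r"
    using outer[of "sgn (A *v v)" "sgn v"] unfolding unit by (simp add: norm_sgn)
  then show "norm (A *v v) \<le> r * norm v"
    by (cases "v = 0") (simp_all add: field_simps)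
qed

lemma compact_dual_ball: "compact (dual_ball :: (complex ^ 'n::finite ^ 'n) set)"
proof -
  let ?f = "\<lambda>p. outer (fst p) (snd p) :: complex ^ 'n ^ 'n"
  have "{outer u v | u v. norm u \<le> 1 \<and> norm v \<le> 1} = ?f ` (cball 0 1 \<times> cball 0 1)"
    by (force simp: image_iff)
  moreover have "continuous_on (cball 0 1 \<times> cball 0 1) ?f"
    unfolding outer_def by (intro continuous_intros)
  ultimately show ?thesis
    unfolding dual_ball_def
    by (auto intro!: compact_convex_hull compact_continuous_image compact_Times)
qed

lemma tensor_outer: "outer u v \<otimes>\<^sub>M outer w z
    = outer (\<chi> p. u $ fst p * w $ snd p) (\<chi> p. v $ fst p * z $ snd p)"
  by (simp add: tensor_def outer_def vec_eq_iff)

lemma norm_tensor_vec: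
  fixes u :: "complex ^ 'n::finite" and w :: "complex ^ 'm::finite"
  shows "norm (\<chi> p. u $ fst p * w $ snd p) = norm u * norm w"
  by (simp add: norm_vec_def L2_set_def sum_prod_UNIV norm_mult power_mult_distrib
      sum_product flip: real_sqrt_mult)

lemma linear_tensor_left: "linear (\<lambda>S. S \<otimes>\<^sub>M T)"
  by (rule linearI) (simp_all add: tensor_def vec_eq_iff algebra_simps)

lemma linear_tensor_right: "linear (\<lambda>T. S \<otimes>\<^sub>M T)"
  by (rule linearI) (simp_all add: tensor_def vec_eq_iff algebra_simps)

text \<open>
  By bilinearity the claim passes from rank-one matrices to their convex hull, one factor at a time.
\<close>

lemma dual_ball_tensor:
  fixes S :: "complex ^ 'n::finite ^ 'n" and T :: "complex ^ 'm::finite ^ 'm"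
  assumes S: "S \<in> dual_ball" and T: "T \<in> dual_ball"
  shows "S \<otimes>\<^sub>M T \<in> dual_ball"
proof -
  have rank_one: "outer u v \<otimes>\<^sub>M outer w z \<in> dual_ball"
    if le: "norm u \<le> 1" "norm v \<le> 1" "norm w \<le> 1" "norm z \<le> 1"
    for u v :: "complex ^ 'n" and w z :: "complex ^ 'm"
  proof -
    have "norm (\<chi> p. x $ fst p * y $ snd p) \<le> 1" if "norm x \<le> 1" "norm y \<le> 1"
      for x :: "complex ^ 'n" and y :: "complex ^ 'm"
      unfolding norm_tensor_vec using that by (simp add: mult_le_one)
    with le show ?thesis
      unfolding tensor_outer by (intro outer_in_dual_ball)
  qed
  have "outer u v \<otimes>\<^sub>M T \<in> dual_ball"
    if "norm u \<le> 1" "norm v \<le> 1" for u v :: "complex ^ 'n"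
  proof -
    have "dual_ball \<subseteq> (\<lambda>T :: complex ^ 'm ^ 'm. outer u v \<otimes>\<^sub>M T) -` dual_ball"
      by (intro dual_ball_subset convex_linear_vimage linear_tensor_right convex_dual_ball)
        (simp add: rank_one that)
    with T show ?thesis by auto
  qed
  then have "dual_ball \<subseteq> (\<lambda>S :: complex ^ 'n ^ 'n. S \<otimes>\<^sub>M T) -` dual_ball"
    by (intro dual_ball_subset convex_linear_vimage linear_tensor_left convex_dual_ball) simp
  with S show ?thesis by auto
qed

section \<open>The quotient norm as a maximum over the dual ball\<close>

lemma osp_norm_le:
  assumes "K \<in> J"
  shows "osp_norm X J \<le> op_norm (X + K)"
  unfolding osp_norm_def
  by (rule cINF_lower[OF _ assms]) (auto intro!: bdd_belowI2 op_norm_nonneg)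

lemma osp_norm_nonneg: "J \<noteq> {} \<Longrightarrow> 0 \<le> osp_norm X J"
  unfolding osp_norm_def by (intro cINF_greatest op_norm_nonneg)

lemma vanishing_on_nonempty: "vanishing_on R \<noteq> {}"
  by (auto simp: vanishing_on_def intro!: exI[of _ 0])

text \<open>
  Let \<open>d\<close> be the quotient norm of \<open>X\<close>, and let \<open>F\<close> send \<open>S\<close> to its pairing with \<open>X\<close> together with its
  part \<open>P S\<close> outside \<open>R\<close>.  The claim is that the compact convex set \<open>F ` dual_ball\<close> contains
  \<open>(d, 0)\<close>.  Otherwise a hyperplane separates the two.  Its normal amounts to a scalar \<open>\<beta>\<close> and a
  matrix \<open>K\<close> that vanishes on \<open>R\<close>, and the separation says that \<open>\<beta> X + K\<close> pairs with every element
  of the dual ball to less than \<open>Re \<beta> * d\<close>.  Hence \<open>\<parallel>\<beta> X + K\<parallel> < \<bar>\<beta>\<bar> d\<close>, and dividing by \<open>\<beta>\<close> gives a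
  member of the coset of \<open>X\<close> of norm less than \<open>d\<close>.

  The first component of \<open>F\<close> is complex so that the value obtained is exactly \<open>d\<close>.  Knowing only its
  real part would not suffice later, when two such values are multiplied.
\<close>

lemma norming_functional_exists:
  fixes X :: "complex ^ 'n::finite ^ 'n"
  obtains S where "S \<in> dual_ball" "S \<in> vanishing_on (- R)"
    "trace_inner X S = of_real (osp_norm X (vanishing_on R))"
proof -
  let ?d = "osp_norm X (vanishing_on R)"
  define P :: "complex ^ 'n ^ 'n \<Rightarrow> complex ^ 'n ^ 'n" where
    "P A = (\<chi> i j. if (i, j) \<in> R then 0 else A $ i $ j)" for A
  define F where "F S = (trace_inner X S, P S)" for S
  have linF: "linear F"
  proof (rule linearI)
    show "F (A + B) = F A + F B" for A B
      by (simp add: F_def P_def linear_add[OF linear_trace_inner] vec_eq_iff)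
    show "F (c *\<^sub>R A) = c *\<^sub>R F A" for c A
      by (simp add: F_def P_def linear_scale[OF linear_trace_inner] vec_eq_iff)
  qed
  have "(of_real ?d, 0) \<in> F ` dual_ball"
  proof (rule ccontr)
    assume "(of_real ?d, 0) \<notin> F ` dual_ball"
    moreover have "convex (F ` dual_ball)"
      by (intro convex_linear_image linF convex_dual_ball)
    moreover have "closed (F ` dual_ball)"
      by (intro compact_imp_closed compact_continuous_image compact_dual_ball
          linear_continuous_on linear_conv_bounded_linear[THEN iffD1] linF)
    ultimately obtain a b where sep: "inner a (of_real ?d, 0) < b"
      "\<And>x. x \<in> F ` dual_ball \<Longrightarrow> b < inner a x"
      using separating_hyperplane_closed_point[of "F ` dual_ball"] by metis
    \<comment> \<open>The signs turn the lower bound of the separation theorem into an upper bound; the conjugate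
      makes the real inner product on \<open>\<complex>\<close> a complex multiplication.\<close>
    define \<beta> K where "\<beta> = - cnj (fst a)" and "K = - P (snd a)"
    have K: "K \<in> vanishing_on R"
      by (auto simp: K_def P_def vanishing_on_def)
    have adj: "inner (cscale \<beta> X + K) S = - inner a (F S)" for S
    proof -
      have "inner (cscale \<beta> X) S = Re (\<beta> * trace_inner X S)"
        by (simp only: Re_trace_inner[symmetric])
          (simp add: trace_inner_eq_sum cscale_def sum_distrib_left mult.assoc)
      moreover have "inner K S = - inner (snd a) (P S)"
        by (auto simp: K_def P_def inner_vec_def simp flip: sum_negf intro!: sum.cong)
      ultimately show ?thesis
        unfolding inner_add_left
        by (simp add: F_def inner_prod_def inner_complex_def) (simp add: \<beta>_def)
    qed
    have "op_norm (cscale \<beta> X + K) \<le> - b"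
    proof (rule op_norm_le_dual)
      fix S :: "complex ^ 'n ^ 'n"
      assume "S \<in> dual_ball"
      then have "b < inner a (F S)" by (intro sep(2) imageI)
      then show "inner (cscale \<beta> X + K) S \<le> - b" by (simp add: adj)
    qed
    also have "- b < Re \<beta> * ?d"
      using sep(1) by (simp add: \<beta>_def inner_prod_def inner_complex_def)
    also have "\<dots> \<le> norm \<beta> * ?d"
      by (intro mult_right_mono complex_Re_le_cmod osp_norm_nonneg vanishing_on_nonempty)
    finally have less: "op_norm (cscale \<beta> X + K) < norm \<beta> * ?d" .
    show False
    proof (cases "\<beta> = 0")
      case True
      then show False using less op_norm_nonneg[of "cscale \<beta> X + K"] by simp
    next
      case False
      have "cscale (1 / \<beta>) K \<in> vanishing_on R"
        using K by (auto simp: vanishing_on_def cscale_def)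
      then have "?d \<le> op_norm (X + cscale (1 / \<beta>) K)"
        by (rule osp_norm_le)
      also have "X + cscale (1 / \<beta>) K = cscale (1 / \<beta>) (cscale \<beta> X + K)"
        using False by (simp add: cmat.scale_right_distrib)
      also note op_norm_cscale_le
      finally show False using less False by (simp add: norm_divide field_simps)
    qed
  qed
  then obtain S where S: "S \<in> dual_ball" "trace_inner X S = of_real ?d" "P S = 0"
    by (auto simp: F_def)
  then have "S \<in> vanishing_on (- R)"
    by (auto simp: P_def vanishing_on_def vec_eq_iff split: if_splits)
  with S that show ?thesis by blast
qed

section \<open>Multiplicativity\<close>

lemma osp_norm_tensor_vanishing_on:
  fixes X :: "complex ^ 'n::finite ^ 'n" and Y :: "complex ^ 'm::finite ^ 'm"
  shows "osp_norm (X \<otimes>\<^sub>M Y) (vanishing_on (rel_tensor R Q))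
    = osp_norm X (vanishing_on R) * osp_norm Y (vanishing_on Q)"
    (is "?t = ?x * ?y")
proof (rule antisym)
  have le: "?t \<le> op_norm (X + K) * op_norm (Y + L)"
    if "K \<in> vanishing_on R" "L \<in> vanishing_on Q" for K L
  proof -
    let ?M = "(X + K) \<otimes>\<^sub>M (Y + L) - X \<otimes>\<^sub>M Y"
    have "?M \<in> vanishing_on (rel_tensor R Q)"
      using that by (fastforce simp: vanishing_on_def rel_tensor_def tensor_def)
    then have "?t \<le> op_norm ((X + K) \<otimes>\<^sub>M (Y + L))"
      using osp_norm_le[of ?M _ "X \<otimes>\<^sub>M Y"] by simp
    also note op_norm_tensor_le
    finally show ?thesis .
  qed
  have INF_mult: "c \<le> osp_norm Z J * r"
    if "J \<noteq> {}" "0 \<le> r" "\<And>K. K \<in> J \<Longrightarrow> c \<le> op_norm (Z + K) * r"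
    for c r and Z :: "complex ^ 'k::finite ^ 'k" and J
  proof (cases "r = 0")
    case True
    then show ?thesis using that by auto
  next
    case False
    with that have "c / r \<le> osp_norm Z J"
      unfolding osp_norm_def by (intro cINF_greatest) (auto simp: field_simps)
    with False that(2) show ?thesis by (simp add: field_simps)
  qed
  have "0 \<le> ?x"
    by (intro osp_norm_nonneg vanishing_on_nonempty)
  moreover have "?t \<le> ?x * op_norm (Y + L)" if "L \<in> vanishing_on Q" for L
    using that by (intro INF_mult vanishing_on_nonempty op_norm_nonneg le)
  ultimately have "?t \<le> ?y * ?x"
    by (intro INF_mult vanishing_on_nonempty) (simp_all add: mult.commute)
  then show "?t \<le> ?x * ?y" by (simp add: mult.commute)

  obtain S where S: "S \<in> dual_ball" "S \<in> vanishing_on (- R)" "trace_inner X S = of_real ?x"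
    by (rule norming_functional_exists)
  obtain T where T: "T \<in> dual_ball" "T \<in> vanishing_on (- Q)" "trace_inner Y T = of_real ?y"
    by (rule norming_functional_exists)
  have "?x * ?y \<le> op_norm (X \<otimes>\<^sub>M Y + M)" if M: "M \<in> vanishing_on (rel_tensor R Q)" for M
  proof -
    have entry: "M $ p $ q * cnj ((S \<otimes>\<^sub>M T) $ p $ q) = 0" for p q
      using M S(2) T(2) by (fastforce simp: vanishing_on_def rel_tensor_def tensor_def)
    have "trace_inner M (S \<otimes>\<^sub>M T) = 0"
      unfolding trace_inner_eq_sum entry by simp
    then have "trace_inner (X \<otimes>\<^sub>M Y + M) (S \<otimes>\<^sub>M T) = of_real (?x * ?y)"
      by (simp add: trace_inner_add_left trace_inner_tensor S(3) T(3))
    then have "?x * ?y = inner (X \<otimes>\<^sub>M Y + M) (S \<otimes>\<^sub>M T)"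
      by (simp flip: Re_trace_inner)
    also have "\<dots> \<le> op_norm (X \<otimes>\<^sub>M Y + M)"
      by (intro inner_le_op_norm dual_ball_tensor S(1) T(1))
    finally show ?thesis .
  qed
  then show "?x * ?y \<le> ?t"
    unfolding osp_norm_def[of "X \<otimes>\<^sub>M Y"] by (intro cINF_greatest vanishing_on_nonempty)
qed

theorem theorem5p3:
  fixes G :: "('n::finite \<times> 'n) set" and X :: "complex ^ 'n ^ 'n"
    and H :: "('m::finite \<times> 'm) set" and Y :: "complex ^ 'm ^ 'm"
  assumes "sym G" and "irrefl G" and "sym H" and "irrefl H"
  shows "osp_norm (X \<otimes>\<^sub>M Y) (orth_complement (op_system (G \<boxtimes> H))) =
           osp_norm X (orth_complement (op_system G)) * osp_norm Y (orth_complement (op_system H))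
         \<and> d_inf (G \<boxtimes> H) (X \<otimes>\<^sub>M Y) = d_inf G X * d_inf H Y"
  by (simp add: d_inf_def orth_complement_op_system strong_product_reflexive_closure
      osp_norm_tensor_vanishing_on)

end
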